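(* Let $T>0$ and let $p:[0,T]\to(1,\infty)$ be continuous with $p(0)=p(T)$. If $\theta:\mathbb{R}\to\mathbb{R}$ is continuous and $e\in L^1([0,T];\mathbb{R})$ satisfies $\int_0^T e(t)\,dt=0$, then the problem $$(\phi_{p(t)}(u'))'+\theta(u)u'=e(t)\ \text{ in }[0,T],\qquad u(0)-u(T)=0=u'(0)-u'(T),$$ has at least one solution $u$ with $\overline{u}=0$.
   Context: For $t\in[0,T]$ and $x\in\mathbb{R}$, $\phi_{p(t)}(x)=|x|^{p(t)-2}x$ (with $\phi_{p(t)}(0)=0$). For $v\in L^1([0,T];\mathbb{R})$, $\overline{v}:=\frac1T\int_0^T v(t)\,dt$. A solution of the problem is a $C^1$ function $u:[0,T]\to\mathbb{R}$ with $u(0)=u(T)$ and $u'(0)=u'(T)$ such that $t\mapsto\phi_{p(t)}(u'(t))$ is absolutely continuous on $[0,T]$ and the differential equation holds for almost every $t\in[0,T]$. *)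

theory Defs
  imports "HOL-Analysis.Analysis"
begin

(* \<phi>\<^bsub>q\<^esub>(x) = |x|^(q - 2) x; the factor x makes the value at 0 equal to 0
   whatever value powr takes there. *)
definition phi :: "real \<Rightarrow> real \<Rightarrow> real" where
  "phi q x = \<bar>x\<bar> powr (q - 2) * x"

definition mean :: "real \<Rightarrow> (real \<Rightarrow> real) \<Rightarrow> real" where
  "mean T v = 1 / T * (LINT t:{0..T}|lebesgue. v t)"

(* Absolute continuity of a function on an interval; unrelated to absolute continuity of
   measures (Radon_Nikodym). Degenerate intervals a i = b i contribute nothing to either sum. *)
definition abs_continuous_on :: "real set \<Rightarrow> (real \<Rightarrow> real) \<Rightarrow> bool" where
  "abs_continuous_on S f \<longleftrightarrow>
    (\<forall>\<epsilon>>0. \<exists>\<delta>>0. \<forall>(n::nat) a b.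
       (\<forall>i<n. a i \<le> b i \<and> {a i..b i} \<subseteq> S) \<longrightarrow>
       disjoint_family_on (\<lambda>i. {a i<..<b i}) {..<n} \<longrightarrow>
       (\<Sum>i<n. b i - a i) < \<delta> \<longrightarrow>
       (\<Sum>i<n. \<bar>f (b i) - f (a i)\<bar>) < \<epsilon>)"

(* du is the derivative u', determined on [0,T] since T > 0; derivatives are taken within [0,T],
   hence are one-sided at the end points. Values outside [0,T] play no role. *)
definition periodic_solution ::
  "real \<Rightarrow> (real \<Rightarrow> real) \<Rightarrow> (real \<Rightarrow> real) \<Rightarrow> (real \<Rightarrow> real) \<Rightarrow> (real \<Rightarrow> real) \<Rightarrow> bool" where
  "periodic_solution T p \<theta> e u \<longleftrightarrow>
    (\<exists>du.
      (\<forall>t\<in>{0..T}. (u has_real_derivative du t) (at t within {0..T})) \<and>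
      continuous_on {0..T} du \<and>
      u 0 = u T \<and> du 0 = du T \<and>
      abs_continuous_on {0..T} (\<lambda>t. phi (p t) (du t)) \<and>
      (AE t\<in>{0..T} in lebesgue.
         \<exists>w. ((\<lambda>s. phi (p s) (du s)) has_real_derivative w) (at t within {0..T}) \<and>
             w + \<theta> (u t) * du t = e t))"

end

theory Submission
  imports Defs "HOL-Complex_Analysis.Great_Picard"
begin

text \<open>
  Let \<open>E\<close> be the integral of \<open>e\<close> from \<open>0\<close> and \<open>\<Theta>\<close> an antiderivative of \<open>\<theta>\<close>. Integrating the equation once gives
  \<open>\<phi>\<^sub>p\<^sub>(\<^sub>t\<^sub>)(u') = c + E(t) - \<Theta>(u)\<close> with a constant \<open>c\<close>, that is \<open>u' = \<psi>(t, c + E(t) - \<Theta>(u))\<close> where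
  \<open>\<psi>(t, \<cdot>)\<close> is the inverse of \<open>\<phi>\<^sub>p\<^sub>(\<^sub>t\<^sub>)\<close>. As \<open>E(0) = E(T)\<close> and \<open>p(0) = p(T)\<close>, equality of \<open>u\<close> at the two end
  points entails equality of \<open>u'\<close>. What remains is a first-order equation in which \<open>c\<close> and the initial
  value \<open>a\<close> of \<open>u\<close> have to be chosen such that \<open>u(T) = u(0)\<close> and \<open>u\<close> has mean zero.

  If \<open>\<Theta>\<close> is bounded, these two conditions have opposite signs on opposite sides of a rectangle of
  pairs \<open>(a, c)\<close>, and the Poincare-Miranda theorem in the plane (a form of Brouwer's theorem) solves
  them, provided that solutions depend continuously on \<open>(a, c)\<close>. The equation has no uniqueness in
  general, so this is done for a delayed equation (\<open>delayed_periodic_solution\<close>), and the delay is sent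
  to zero by the Arzela-Ascoli theorem (\<open>periodic_solution_with_parameter\<close>).

  If \<open>\<Theta>\<close> is unbounded, it is truncated. Multiplying the integrated equation by \<open>u'\<close> and integrating
  over the period, \<open>c\<close> and \<open>\<Theta>\<close> cancel by periodicity, and since \<open>\<phi>\<^sub>p\<^sub>(\<^sub>t\<^sub>)(x) x\<close> grows faster than \<open>\<bar>x\<bar>\<close> one obtains a
  bound on \<open>u\<close> in terms of \<open>E\<close> only (\<open>periodic_solution_a_priori_bound\<close>). A truncation beyond this bound
  leaves the solution untouched.

  Finally \<open>\<phi>\<^sub>p\<^sub>(\<^sub>t\<^sub>)(u') = c + E - \<Theta>(u)\<close> is absolutely continuous, as \<open>E\<close> is and \<open>\<Theta>(u)\<close> is continuously
  differentiable; Lebesgue's differentiation theorem for \<open>E\<close> returns the equation almost everywhere.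
\<close>

section \<open>Periodic solutions of first-order equations with a free parameter\<close>

text \<open>
  Truncating \<open>z - (F z, G z)\<close> coordinatewise to the rectangle gives a continuous self-map. At a fixed
  point of it the truncation is inactive, unless a coordinate sits on the boundary; there the sign
  condition forces the corresponding component of the field to vanish anyway.
\<close>

lemma Poincare_Miranda_plane:
  fixes F G :: "real \<times> real \<Rightarrow> real"
  assumes "0 \<le> A" "0 \<le> C"
    and contF: "continuous_on ({-A..A} \<times> {-C..C}) F"
    and contG: "continuous_on ({-A..A} \<times> {-C..C}) G"
    and F: "\<And>y. \<bar>y\<bar> \<le> C \<Longrightarrow> F (-A, y) \<le> 0" "\<And>y. \<bar>y\<bar> \<le> C \<Longrightarrow> 0 \<le> F (A, y)"
    and G: "\<And>x. \<bar>x\<bar> \<le> A \<Longrightarrow> G (x, -C) \<le> 0" "\<And>x. \<bar>x\<bar> \<le> A \<Longrightarrow> 0 \<le> G (x, C)"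
  obtains x y where "\<bar>x\<bar> \<le> A" "\<bar>y\<bar> \<le> C" "F (x, y) = 0" "G (x, y) = 0"
proof -
  let ?S = "{-A..A} \<times> {-C..C}"
  define h where "h z = (max (-A) (min A (fst z - F z)), max (-C) (min C (snd z - G z)))" for z
  have "compact ?S" "convex ?S" "?S \<noteq> {}"
    using assms(1,2) by (auto intro!: compact_Times convex_Times)
  moreover have "continuous_on ?S h"
    unfolding h_def by (intro continuous_intros contF contG)
  moreover have "h \<in> ?S \<rightarrow> ?S"
    using assms(1,2) by (auto simp: h_def)
  ultimately obtain z where z: "z \<in> ?S" "h z = z" by (rule brouwer)
  obtain x y where xy: "z = (x, y)" by (cases z)
  have hx: "max (-A) (min A (x - F (x,y))) = x" and hy: "max (-C) (min C (y - G (x,y))) = y"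
    using z(2) by (auto simp: h_def xy)
  have b: "\<bar>x\<bar> \<le> A" "\<bar>y\<bar> \<le> C" using z(1) by (auto simp: xy)
  have "F (x, y) = 0"
    using hx F[OF b(2)] b by (cases "x = A"; cases "x = -A") (auto simp: max_def min_def split: if_splits)
  moreover have "G (x, y) = 0"
    using hy G[OF b(1)] b by (cases "y = C"; cases "y = -C") (auto simp: max_def min_def split: if_splits)
  ultimately show thesis using that b by blast
qed

text \<open>
  Moving the variable endpoint into the integrand makes the theorem on parameter integrals over a
  fixed box applicable to indefinite integrals.
\<close>

lemma integral_rescale_to_unit:
  fixes g :: "real \<Rightarrow> real"
  assumes "continuous_on {0..t} g" "0 \<le> t"
  shows "t * integral {0..1} (\<lambda>s. g (t * s)) = integral {0..t} g"
proof (cases "t = 0")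
  case False
  then have t: "t > 0" using assms by simp
  have "(g has_integral integral {0..t} g) (cbox 0 t)"
    using integrable_continuous_real[OF assms(1)] by (simp add: integrable_integral)
  from has_integral_affinity'[OF this t, of 0] t
  have "((\<lambda>s. g (t * s)) has_integral integral {0..t} g / t) {0..1}"
    by (simp add: field_simps)
  then show ?thesis using t by (simp add: integral_unique)
qed simp

text \<open>
  The iterates of \<open>V \<mapsto> (\<lambda>t. a + \<integral>\<^sub>0\<^sup>t f c s (V (max 0 (s - h))) ds)\<close> with \<open>z = (a, c)\<close>, started at the constant
  \<open>a\<close>, the integral being rescaled to the unit interval. The delay \<open>h\<close> is Tonelli's device: for
  \<open>h > 0\<close> the iteration becomes stationary on every bounded interval, which yields solutions depending
  continuously on \<open>(a, c)\<close> although \<open>f\<close> is merely continuous and the undelayed equation may have many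
  solutions for given data.
\<close>

primrec delay_iterate ::
  "(real \<Rightarrow> real \<Rightarrow> real \<Rightarrow> real) \<Rightarrow> real \<Rightarrow> nat \<Rightarrow> real \<times> real \<Rightarrow> real \<Rightarrow> real" where
  "delay_iterate f h 0 z t = fst z"
| "delay_iterate f h (Suc k) z t =
     fst z + t * integral {0..1} (\<lambda>s. f (snd z) (t * s) (delay_iterate f h k z (max 0 (t * s - h))))"

lemma continuous_on_delay_iterate:
  assumes f: "continuous_on UNIV (\<lambda>(c, t, x). f c t x)"
  shows "continuous_on UNIV (\<lambda>(z, t). delay_iterate f h k z t)"
proof (induction k)
  case 0
  then show ?case by (auto simp: case_prod_unfold intro!: continuous_intros)
next
  case (Suc k)
  let ?g = "\<lambda>w s. f (snd (fst w)) (snd w * s) (delay_iterate f h k (fst w) (max 0 (snd w * s - h)))"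
  have prev: "continuous_on UNIV (\<lambda>v. delay_iterate f h k (fst (fst v)) (max 0 (snd (fst v) * snd v - h)))"
    by (rule continuous_on_compose2[OF Suc, where f = "\<lambda>v. (fst (fst v), max 0 (snd (fst v) * snd v - h))", simplified])
       (intro continuous_intros)
  have "continuous_on (UNIV \<times> cbox 0 1) (\<lambda>(w, s). ?g w s)"
  proof -
    have "continuous_on UNIV (\<lambda>v. ?g (fst v) (snd v))"
      by (rule continuous_on_compose2[OF f, where f = "\<lambda>v. (snd (fst (fst v)), snd (fst v) * snd v,
         delay_iterate f h k (fst (fst v)) (max 0 (snd (fst v) * snd v - h)))", simplified])
        (intro continuous_intros prev)
    then show ?thesis by (auto simp: case_prod_unfold intro: continuous_on_subset)
  qed
  then have "continuous_on UNIV (\<lambda>w. integral (cbox 0 1) (?g w))"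
    by (rule integral_continuous_on_param)
  then show ?case by (auto simp: case_prod_unfold intro!: continuous_intros)
qed

text \<open>
  By the delay, values on \<open>[0, (k + 1) h]\<close> of one iterate depend only on values on \<open>[0, k h]\<close> of the
  preceding one.
\<close>

lemma delay_iterate_stationary:
  assumes "0 \<le> h" "0 \<le> t" "t \<le> real k * h"
  shows "delay_iterate f h (Suc k) z t = delay_iterate f h k z t"
  using assms(2,3)
proof (induction k arbitrary: t)
  case 0
  then show ?case by simp
next
  case (Suc k)
  have "delay_iterate f h (Suc k) z (max 0 (t * s - h)) = delay_iterate f h k z (max 0 (t * s - h))"
    if "s \<in> {0..1}" for s
  proof (rule Suc.IH)
    have "t * s \<le> t" using that Suc.prems(1) by (simp add: mult_left_le)
    then show "max 0 (t * s - h) \<le> real k * h"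
      using Suc.prems assms(1) by (auto simp: algebra_simps)
  qed simp
  then have "integral {0..1} (\<lambda>s. f (snd z) (t * s) (delay_iterate f h (Suc k) z (max 0 (t * s - h))))
     = integral {0..1} (\<lambda>s. f (snd z) (t * s) (delay_iterate f h k z (max 0 (t * s - h))))"
    by (intro integral_cong) simp
  then show ?case by (subst (1 2) delay_iterate.simps(2)) simp
qed

lemma continuous_on_triple_compose:
  fixes f :: "real \<Rightarrow> real \<Rightarrow> real \<Rightarrow> real"
  assumes "continuous_on UNIV (\<lambda>(c, t, x). f c t x)"
    and "continuous_on S c" "continuous_on S t" "continuous_on S x"
  shows "continuous_on S (\<lambda>s. f (c s) (t s) (x s))"
  by (rule continuous_on_compose2[OF assms(1), where f = "\<lambda>s. (c s, t s, x s)", simplified])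
     (intro continuous_intros assms)

text \<open>
  The solution of the delayed equation is a continuous function of its initial value \<open>a\<close> and of the
  parameter \<open>c\<close>, so the two conditions on it form a system of two scalar equations in the plane. Since
  the solution stays within \<open>K T\<close> of \<open>a\<close>, its integral has the sign of \<open>a\<close> for \<open>a = \<plusminus> K T\<close>; since \<open>f\<close> has
  a sign for \<open>c = \<plusminus> C\<close>, so has the increment over the period.
\<close>

lemma delayed_periodic_solution:
  fixes f :: "real \<Rightarrow> real \<Rightarrow> real \<Rightarrow> real"
  assumes "T > 0" "C \<ge> 0" and n: "n > 0" and h: "h = T / real n"
    and f: "continuous_on UNIV (\<lambda>(c, t, x). f c t x)"
    and bound: "\<And>c t x. \<bar>c\<bar> \<le> C \<Longrightarrow> \<bar>f c t x\<bar> \<le> K"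
    and sign: "\<And>t x. 0 \<le> f C t x" "\<And>t x. f (-C) t x \<le> 0"
  obtains c U where "\<bar>c\<bar> \<le> C" "\<bar>U 0\<bar> \<le> K * T" "U T = U 0" "integral {0..T} U = 0"
    "continuous_on UNIV U"
    "\<And>t. t \<in> {0..T} \<Longrightarrow> U t = U 0 + integral {0..t} (\<lambda>s. f c s (U (max 0 (s - h))))"
proof -
  let ?V = "delay_iterate f h n"
  have h0: "0 \<le> h" using h \<open>T > 0\<close> by simp
  have nh: "real n * h = T" using n h by simp
  have K: "0 \<le> K" using bound[of 0 0 0] \<open>C \<ge> 0\<close> by linarith
  have contV: "continuous_on UNIV (\<lambda>(z, t). ?V z t)"
    by (rule continuous_on_delay_iterate[OF f])
  have contU: "continuous_on S (?V z)" for z S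
    by (rule continuous_on_compose2[OF contV, where f = "\<lambda>t. (z, t)", simplified])
       (intro continuous_intros)
  have contg: "continuous_on S (\<lambda>s. f (snd z) s (?V z (max 0 (s - h))))" for z S
    by (intro continuous_on_triple_compose[OF f] continuous_intros continuous_on_compose2[OF contU[of UNIV]]) auto
  have eq: "?V z t = fst z + integral {0..t} (\<lambda>s. f (snd z) s (?V z (max 0 (s - h))))"
    if "t \<in> {0..T}" for z t
  proof -
    have "?V z t = delay_iterate f h (Suc n) z t"
      using delay_iterate_stationary[OF h0, of t n f z] that nh by simp
    also have "\<dots> = fst z + integral {0..t} (\<lambda>s. f (snd z) s (?V z (max 0 (s - h))))"
      using that by (simp add: integral_rescale_to_unit[OF contg])
    finally show ?thesis .
  qed
  have start: "?V z 0 = fst z" for z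
    using eq[of 0 z] \<open>T > 0\<close> by simp
  have near: "\<bar>?V z t - fst z\<bar> \<le> K * T" if "t \<in> {0..T}" "\<bar>snd z\<bar> \<le> C" for z t
  proof -
    have "norm (integral {0..t} (\<lambda>s. f (snd z) s (?V z (max 0 (s - h))))) \<le> K * (t - 0)"
      using that bound by (intro integral_bound contg) auto
    also have "\<dots> \<le> K * T" using that K by (simp add: mult_left_mono)
    finally show ?thesis using eq[OF that(1), of z] by simp
  qed
  define F where "F z = integral {0..T} (?V z)" for z
  define G where "G z = ?V z T - fst z" for z
  have KT: "0 \<le> K * T" using K \<open>T > 0\<close> by simp
  obtain a c where ac: "\<bar>a\<bar> \<le> K * T" "\<bar>c\<bar> \<le> C" "F (a, c) = 0" "G (a, c) = 0"
  proof (rule Poincare_Miranda_plane[OF KT \<open>C \<ge> 0\<close>])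
    have "continuous_on UNIV (\<lambda>z. integral (cbox 0 T) (?V z))"
      by (rule integral_continuous_on_param) (rule continuous_on_subset[OF contV], simp)
    then show "continuous_on ({- (K * T)..K * T} \<times> {- C..C}) F"
      unfolding F_def by (auto intro: continuous_on_subset)
    have "continuous_on UNIV (\<lambda>z. ?V z T)"
      by (rule continuous_on_compose2[OF contV, where f = "\<lambda>z. (z, T)", simplified])
         (intro continuous_intros)
    then show "continuous_on ({- (K * T)..K * T} \<times> {- C..C}) G"
      unfolding G_def by (intro continuous_intros) (auto intro: continuous_on_subset)
    show "F (- (K * T), y) \<le> 0" if "\<bar>y\<bar> \<le> C" for y
    proof -
      have "integral {0..T} (?V (- (K * T), y)) \<le> integral {0..T} (\<lambda>_. 0)"
        using near[of _ "(- (K * T), y)"] that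
        by (intro integral_le integrable_continuous_real contU) (force simp: abs_le_iff)+
      then show ?thesis by (simp add: F_def)
    qed
    show "0 \<le> F (K * T, y)" if "\<bar>y\<bar> \<le> C" for y
      unfolding F_def using near[of _ "(K * T, y)"] that
      by (intro integral_nonneg integrable_continuous_real contU) (force simp: abs_le_iff)+
    show "G (x, -C) \<le> 0" for x
    proof -
      have "integral {0..T} (\<lambda>s. f (-C) s (?V (x, -C) (max 0 (s - h)))) \<le> integral {0..T} (\<lambda>_. 0)"
        using contg[of _ "(x, -C)"] sign by (intro integral_le integrable_continuous_real) auto
      then show ?thesis using eq[of T "(x, -C)"] \<open>T > 0\<close> by (simp add: G_def)
    qed
    show "0 \<le> G (x, C)" for x
    proof -
      have "0 \<le> integral {0..T} (\<lambda>s. f C s (?V (x, C) (max 0 (s - h))))"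
        using contg[of _ "(x, C)"] sign by (intro integral_nonneg integrable_continuous_real) auto
      then show ?thesis using eq[of T "(x, C)"] \<open>T > 0\<close> by (simp add: G_def)
    qed
  qed
  show thesis
    by (rule that[of c "?V (a, c)"]) (use ac contU eq[of _ "(a, c)"] in \<open>auto simp: start F_def G_def\<close>)
qed

text \<open>
  The delayed solutions for the delays \<open>T / (n + 1)\<close> are bounded and share the Lipschitz constant \<open>K\<close>, so a
  subsequence converges uniformly, together with its parameters, and the delay disappears in the
  limit of the integral equation.
\<close>

lemma periodic_solution_with_parameter:
  fixes f :: "real \<Rightarrow> real \<Rightarrow> real \<Rightarrow> real"
  assumes "T > 0" "C \<ge> 0"
    and f: "continuous_on UNIV (\<lambda>(c, t, x). f c t x)"
    and bound: "\<And>c t x. \<bar>c\<bar> \<le> C \<Longrightarrow> \<bar>f c t x\<bar> \<le> K"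
    and sign: "\<And>t x. 0 \<le> f C t x" "\<And>t x. f (-C) t x \<le> 0"
  obtains c u where "\<And>t. t \<in> {0..T} \<Longrightarrow> (u has_real_derivative f c t (u t)) (at t within {0..T})"
    "u 0 = u T" "integral {0..T} u = 0"
proof -
  define h where "h n = T / real (Suc n)" for n
  define Q where "Q n c U \<longleftrightarrow>
      \<bar>c\<bar> \<le> C \<and> \<bar>U 0\<bar> \<le> K * T \<and> U T = U 0 \<and> integral {0..T} U = 0 \<and> continuous_on UNIV U \<and>
      (\<forall>t\<in>{0..T}. U t = U 0 + integral {0..t} (\<lambda>s. f c s (U (max 0 (s - h n)))))" for n c U
  have "\<exists>c U. Q n c U" for n
  proof (rule delayed_periodic_solution[OF assms(1,2) zero_less_Suc h_def[of n] f bound sign])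
    fix c U
    assume "\<bar>c\<bar> \<le> C" "\<bar>U 0\<bar> \<le> K * T" "U T = U 0" "integral {0..T} U = 0" "continuous_on UNIV U"
      "\<And>t. t \<in> {0..T} \<Longrightarrow> U t = U 0 + integral {0..t} (\<lambda>s. f c s (U (max 0 (s - h n))))"
    note cU = this
    have "Q n c U" unfolding Q_def by (intro conjI ballI cU)
    then show ?thesis by blast
  qed
  then obtain c U where Q: "\<And>n. Q n (c n) (U n)" by metis
  have cU: "\<bar>c n\<bar> \<le> C" "\<bar>U n 0\<bar> \<le> K * T" "U n T = U n 0"
      "integral {0..T} (U n) = 0" "continuous_on UNIV (U n)"
      "t \<in> {0..T} \<Longrightarrow> U n t = U n 0 + integral {0..t} (\<lambda>s. f (c n) s (U n (max 0 (s - h n))))" for n t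
    using Q[of n] unfolding Q_def by blast+
  have K: "0 \<le> K" using bound[of 0 0 0] \<open>C \<ge> 0\<close> by linarith
  have contg: "continuous_on S (\<lambda>s. f (c n) s (U n (max 0 (s - h n))))" for n S
    by (intro continuous_on_triple_compose[OF f] continuous_intros continuous_on_compose2[OF cU(5)]) auto
  have lip: "\<bar>U n x - U n y\<bar> \<le> K * \<bar>x - y\<bar>" if "x \<in> {0..T}" "y \<in> {0..T}" for n x y
  proof -
    have der: "(U n has_field_derivative f (c n) t (U n (max 0 (t - h n)))) (at t within {0..T})"
      if t: "t \<in> {0..T}" for t
    proof (rule has_field_derivative_transform_within[OF _ zero_less_one t])
      show "((\<lambda>t. U n 0 + integral {0..t} (\<lambda>s. f (c n) s (U n (max 0 (s - h n)))))
         has_field_derivative f (c n) t (U n (max 0 (t - h n)))) (at t within {0..T})"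
        using t by (auto intro!: derivative_eq_intros integral_has_real_derivative contg)
      show "U n 0 + integral {0..x} (\<lambda>s. f (c n) s (U n (max 0 (s - h n)))) = U n x"
        if "x \<in> {0..T}" for x
        using cU(6)[OF that] by (rule sym)
    qed
    then show ?thesis
      using field_differentiable_bound[OF _ der, of K x y] that bound[OF cU(1)] by simp
  qed
  \<comment> \<open>Carrying the parameter along as a constant second component extracts one common subsequence.\<close>
  let ?F = "\<lambda>n t. (U n t, c n)"
  obtain g k where g: "continuous_on {0..T} g" and k: "strict_mono (k :: nat \<Rightarrow> nat)"
    and conv: "\<And>e. 0 < e \<Longrightarrow> \<exists>N. \<forall>n x. n \<ge> N \<and> x \<in> {0..T} \<longrightarrow> norm (?F (k n) x - g x) < e"
  proof (rule Arzela_Ascoli[of "{0..T}" ?F "2 * (K * T) + C"])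
    show "norm (?F n x) \<le> 2 * (K * T) + C" if "x \<in> {0..T}" for n x
    proof -
      have "\<bar>U n x - U n 0\<bar> \<le> K * T"
        using lip[of x 0 n] that \<open>T > 0\<close> K by (auto intro: order_trans mult_left_mono)
      then have "\<bar>U n x\<bar> \<le> 2 * (K * T)" using cU(2)[of n] by linarith
      then show ?thesis using norm_Pair_le[of "U n x" "c n"] cU(1)[of n] by simp
    qed
    show "\<exists>d>0. \<forall>n y. y \<in> {0..T} \<and> norm (x - y) < d \<longrightarrow> norm (?F n x - ?F n y) < e"
      if "x \<in> {0..T}" "0 < e" for x e
    proof (intro exI conjI allI impI)
      show "0 < e / (K + 1)" using K that by simp
      fix n y assume y: "y \<in> {0..T} \<and> norm (x - y) < e / (K + 1)"
      have "\<bar>U n x - U n y\<bar> \<le> (K + 1) * \<bar>x - y\<bar>"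
        using lip[of x y n] y that by (auto simp: algebra_simps)
      also have "\<dots> < e" using y K by (simp add: field_simps)
      finally show "norm (?F n x - ?F n y) < e" by simp
    qed
  qed auto
  define u where "u t = fst (g t)" for t
  define b where "b = snd (g 0)"
  have lim: "(\<lambda>n. ?F (k n) t) \<longlonglongrightarrow> g t" if "t \<in> {0..T}" for t
    unfolding LIMSEQ_iff using conv that by meson
  have Ulim: "(\<lambda>n. U (k n) t) \<longlonglongrightarrow> u t" if "t \<in> {0..T}" for t
    using tendsto_fst[OF lim[OF that]] by (simp add: u_def)
  have clim: "(\<lambda>n. c (k n)) \<longlonglongrightarrow> b"
    using tendsto_snd[OF lim[of 0]] \<open>T > 0\<close> by (simp add: b_def)
  have contu: "continuous_on {0..T} u"
    unfolding u_def by (intro continuous_intros g)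
  have h: "(\<lambda>n. h (k n)) \<longlonglongrightarrow> 0"
  proof -
    have "h \<longlonglongrightarrow> 0"
      unfolding h_def by (rule LIMSEQ_Suc[of "\<lambda>n. T / real n"]) (rule lim_const_over_n)
    then show ?thesis using LIMSEQ_subseq_LIMSEQ[OF _ k] by (simp add: o_def)
  qed
  have hpos: "0 \<le> h n" for n using \<open>T > 0\<close> by (simp add: h_def)
  \<comment> \<open>A delay \<open>h\<close> changes the values of a \<open>K\<close>-Lipschitz function by at most \<open>K h\<close>.\<close>
  have delaylim: "(\<lambda>n. U (k n) (max 0 (s - h (k n)))) \<longlonglongrightarrow> u s" if s: "s \<in> {0..T}" for s
  proof -
    have "(\<lambda>n. U (k n) (max 0 (s - h (k n))) - U (k n) s) \<longlonglongrightarrow> 0"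
    proof (rule Lim_null_comparison)
      have "norm (U (k n) (max 0 (s - h (k n))) - U (k n) s) \<le> K * h (k n)" for n
      proof -
        have "norm (U (k n) (max 0 (s - h (k n))) - U (k n) s) \<le> K * \<bar>max 0 (s - h (k n)) - s\<bar>"
          using lip[of "max 0 (s - h (k n))" s "k n"] s hpos[of "k n"] by auto
        also have "\<dots> \<le> K * h (k n)"
          using s hpos[of "k n"] K by (intro mult_left_mono) auto
        finally show ?thesis .
      qed
      then show "\<forall>\<^sub>F n in sequentially. norm (U (k n) (max 0 (s - h (k n))) - U (k n) s) \<le> K * h (k n)"
        by simp
      show "(\<lambda>n. K * h (k n)) \<longlonglongrightarrow> 0" using tendsto_mult_right_zero[OF h] by simp
    qed
    from tendsto_add[OF this Ulim[OF s]] show ?thesis by simp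
  qed
  have rhslim: "(\<lambda>n. f (c (k n)) s (U (k n) (max 0 (s - h (k n))))) \<longlonglongrightarrow> f b s (u s)"
    if s: "s \<in> {0..T}" for s
  proof -
    have "(\<lambda>n. (c (k n), s, U (k n) (max 0 (s - h (k n))))) \<longlonglongrightarrow> (b, s, u s)"
      by (intro tendsto_intros clim delaylim s)
    from continuous_on_tendsto_compose[OF f this] show ?thesis by simp
  qed
  have inteq: "u t = u 0 + integral {0..t} (\<lambda>s. f b s (u s))" if t: "t \<in> {0..T}" for t
  proof -
    have "(\<lambda>n. integral {0..t} (\<lambda>s. f (c (k n)) s (U (k n) (max 0 (s - h (k n))))))
       \<longlonglongrightarrow> integral {0..t} (\<lambda>s. f b s (u s))"
    proof (rule dominated_convergence(2)[where h = "\<lambda>_. K"])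
      show "(\<lambda>s. f (c (k n)) s (U (k n) (max 0 (s - h (k n))))) integrable_on {0..t}" for n
        by (intro integrable_continuous_real contg)
    qed (use bound[OF cU(1)] rhslim t in auto)
    then have "(\<lambda>n. U (k n) 0 + integral {0..t} (\<lambda>s. f (c (k n)) s (U (k n) (max 0 (s - h (k n))))))
       \<longlonglongrightarrow> u 0 + integral {0..t} (\<lambda>s. f b s (u s))"
      using \<open>T > 0\<close> by (intro tendsto_intros Ulim) auto
    then have "(\<lambda>n. U (k n) t) \<longlonglongrightarrow> u 0 + integral {0..t} (\<lambda>s. f b s (u s))"
      using cU(6)[OF t] by simp
    with Ulim[OF t] show ?thesis by (rule LIMSEQ_unique)
  qed
  show thesis
  proof (rule that)
    fix t assume t: "t \<in> {0..T}"
    show "(u has_real_derivative f b t (u t)) (at t within {0..T})"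
    proof (rule has_field_derivative_transform_within[OF _ zero_less_one t])
      show "((\<lambda>t. u 0 + integral {0..t} (\<lambda>s. f b s (u s))) has_real_derivative f b t (u t))
         (at t within {0..T})"
        using t by (auto intro!: derivative_eq_intros integral_has_real_derivative
          continuous_on_triple_compose[OF f] contu continuous_intros)
      show "u 0 + integral {0..x} (\<lambda>s. f b s (u s)) = u x" if "x \<in> {0..T}" for x
        using inteq[OF that] by (rule sym)
    qed
  next
    have "(\<lambda>n. U (k n) T) \<longlonglongrightarrow> u T" "(\<lambda>n. U (k n) 0) \<longlonglongrightarrow> u 0"
      using \<open>T > 0\<close> by (auto intro: Ulim)
    then show "u 0 = u T" by (simp add: cU(3) LIMSEQ_unique)
  next
    have "(\<lambda>n. integral {0..T} (U (k n))) \<longlonglongrightarrow> integral {0..T} u"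
    proof (rule dominated_convergence(2)[where h = "\<lambda>_. 2 * (K * T)"])
      show "U (k n) integrable_on {0..T}" for n
        by (intro integrable_continuous_real continuous_on_subset[OF cU(5)]) simp
      show "norm (U (k n) x) \<le> 2 * (K * T)" if "x \<in> {0..T}" for n x
      proof -
        have "\<bar>U (k n) x - U (k n) 0\<bar> \<le> K * T"
          using lip[of x 0 "k n"] that \<open>T > 0\<close> K by (auto intro: order_trans mult_left_mono)
        then show ?thesis using cU(2)[of "k n"] by auto
      qed
    qed (use Ulim in auto)
    then show "integral {0..T} u = 0" using cU(4) by (simp add: LIMSEQ_const_iff)
  qed
qed

section \<open>Absolute continuity and almost everywhere differentiability of integrals\<close>

text \<open>
  The excess decreases pointwise to zero as \<open>N\<close> grows and is dominated by \<open>\<bar>e\<bar>\<close>.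
\<close>

lemma small_integral_of_truncation_excess:
  fixes e :: "real \<Rightarrow> real"
  assumes "e absolutely_integrable_on {a..b}" "0 < \<epsilon>"
  obtains N :: real where "N > 0" "(\<lambda>x. max 0 (\<bar>e x\<bar> - N)) integrable_on {a..b}"
    "integral {a..b} (\<lambda>x. max 0 (\<bar>e x\<bar> - N)) < \<epsilon>"
proof -
  have abs: "(\<lambda>x. \<bar>e x\<bar>) integrable_on {a..b}"
    using assms(1) by (simp add: absolutely_integrable_on_def)
  have int: "(\<lambda>x. max 0 (\<bar>e x\<bar> - N)) integrable_on {a..b}" for N
  proof -
    have "(\<lambda>x. \<bar>e x\<bar> - N) absolutely_integrable_on {a..b}"
      using assms(1) by (intro set_integral_diff(1) set_integrable_abs)
        (auto intro: absolutely_integrable_continuous_real)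
    then have "(\<lambda>x. max 0 (\<bar>e x\<bar> - N)) absolutely_integrable_on {a..b}"
      by (intro absolutely_integrable_max_1)
        (simp_all add: absolutely_integrable_continuous_real)
    then show ?thesis by (rule set_lebesgue_integral_eq_integral(1))
  qed
  have "(\<lambda>n. integral {a..b} (\<lambda>x. max 0 (\<bar>e x\<bar> - real n))) \<longlonglongrightarrow> integral {a..b} (\<lambda>x. 0)"
  proof (rule dominated_convergence(2)[where h = "\<lambda>x. \<bar>e x\<bar>"])
    show "(\<lambda>n. max 0 (\<bar>e x\<bar> - real n)) \<longlonglongrightarrow> 0" for x
    proof (rule tendsto_eventually)
      show "\<forall>\<^sub>F n in sequentially. max 0 (\<bar>e x\<bar> - real n) = 0"
        using eventually_ge_at_top[of "nat \<lceil>\<bar>e x\<bar>\<rceil>"]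
        by eventually_elim linarith
    qed
  qed (use int abs in auto)
  then have "\<forall>\<^sub>F n in sequentially. integral {a..b} (\<lambda>x. max 0 (\<bar>e x\<bar> - real n)) < \<epsilon>"
    using assms(2) by (intro order_tendstoD(2)) auto
  then have "\<forall>\<^sub>F n in sequentially. n > 0 \<and> integral {a..b} (\<lambda>x. max 0 (\<bar>e x\<bar> - real n)) < \<epsilon>"
    using eventually_gt_at_top[of 0] by eventually_elim simp
  then obtain n :: nat where "n > 0" "integral {a..b} (\<lambda>x. max 0 (\<bar>e x\<bar> - real n)) < \<epsilon>"
    by (auto simp: eventually_sequentially)
  then show thesis using that[of "real n"] int[of "real n"] by simp
qed

text \<open>
  Up to an excess of small total integral, \<open>\<bar>e\<bar>\<close> is bounded by a constant \<open>N\<close>, and the integral of that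
  constant over the given intervals is \<open>N\<close> times their total length.
\<close>

lemma abs_continuous_on_integral:
  fixes e :: "real \<Rightarrow> real"
  assumes e: "e absolutely_integrable_on {0..T}"
  shows "abs_continuous_on {0..T} (\<lambda>t. integral {0..t} e)"
  unfolding abs_continuous_on_def
proof (intro allI impI)
  fix \<epsilon> :: real assume "0 < \<epsilon>"
  then obtain N where N: "N > 0" "(\<lambda>x. max 0 (\<bar>e x\<bar> - N)) integrable_on {0..T}"
      "integral {0..T} (\<lambda>x. max 0 (\<bar>e x\<bar> - N)) < \<epsilon> / 2"
    using small_integral_of_truncation_excess[OF e, of "\<epsilon> / 2"] by auto
  let ?r = "\<lambda>x. max 0 (\<bar>e x\<bar> - N)"
  have int: "e integrable_on {0..T}" "(\<lambda>x. \<bar>e x\<bar>) integrable_on {0..T}"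
    using e by (simp_all add: absolutely_integrable_on_def)
  show "\<exists>\<delta>>0. \<forall>(n::nat) a b. (\<forall>i<n. a i \<le> b i \<and> {a i..b i} \<subseteq> {0..T}) \<longrightarrow>
      disjoint_family_on (\<lambda>i. {a i<..<b i}) {..<n} \<longrightarrow> (\<Sum>i<n. b i - a i) < \<delta> \<longrightarrow>
      (\<Sum>i<n. \<bar>integral {0..b i} e - integral {0..a i} e\<bar>) < \<epsilon>"
  proof (intro exI[of _ "\<epsilon> / (2 * N)"] conjI allI impI)
    show "0 < \<epsilon> / (2 * N)" using N \<open>0 < \<epsilon>\<close> by simp
    fix n :: nat and a b :: "nat \<Rightarrow> real"
    assume ab: "\<forall>i<n. a i \<le> b i \<and> {a i..b i} \<subseteq> {0..T}"
      and disj: "disjoint_family_on (\<lambda>i. {a i<..<b i}) {..<n}"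
      and small: "(\<Sum>i<n. b i - a i) < \<epsilon> / (2 * N)"
    have rint: "?r integrable_on {a i..b i}" if "i < n" for i
      using ab that by (intro integrable_on_subinterval[OF N(2)]) auto
    have one: "\<bar>integral {0..b i} e - integral {0..a i} e\<bar> \<le> N * (b i - a i) + integral {a i..b i} ?r"
      if i: "i < n" for i
    proof -
      have le: "0 \<le> a i" "a i \<le> b i" "b i \<le> T" using ab i by auto
      have sub: "e integrable_on {a i..b i}" "(\<lambda>x. \<bar>e x\<bar>) integrable_on {a i..b i}"
        using le by (auto intro!: integrable_on_subinterval[OF int(1)] integrable_on_subinterval[OF int(2)])
      have "integral {0..a i} e + integral {a i..b i} e = integral {0..b i} e"
        using le by (intro Henstock_Kurzweil_Integration.integral_combine
            integrable_on_subinterval[OF int(1)]) auto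
      then have "\<bar>integral {0..b i} e - integral {0..a i} e\<bar> = \<bar>integral {a i..b i} e\<bar>" by simp
      also have "\<dots> \<le> integral {a i..b i} (\<lambda>x. N + ?r x)"
        using integral_norm_bound_integral[OF sub(1), of "\<lambda>x. N + ?r x"] rint[OF i]
        by (force intro: integrable_add)
      also have "\<dots> = N * (b i - a i) + integral {a i..b i} ?r"
        using rint[OF i] le by (subst Henstock_Kurzweil_Integration.integral_add) auto
      finally show ?thesis .
    qed
    have "(?r has_integral (\<Sum>i<n. integral {a i..b i} ?r)) (\<Union>i<n. {a i<..<b i})"
    proof (rule has_integral_UN)
      show "(?r has_integral integral {a i..b i} ?r) {a i<..<b i}" if "i \<in> {..<n}" for i
        using integrable_integral[OF rint[of i]] that
        by (simp add: has_integral_Icc_iff_Ioo)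
      show "pairwise (\<lambda>i i'. negligible ({a i<..<b i} \<inter> {a i'<..<b i'})) {..<n}"
        using disj by (auto simp: pairwise_def disjoint_family_on_def)
    qed simp
    then have "(\<Sum>i<n. integral {a i..b i} ?r) \<le> integral {0..T} ?r"
    proof (rule has_integral_subset_le[OF _ _ integrable_integral[OF N(2)], rotated])
      show "(\<Union>i<n. {a i<..<b i}) \<subseteq> {0..T}" using ab by force
    qed simp
    moreover have "N * (\<Sum>i<n. b i - a i) < \<epsilon> / 2"
      using small N(1) by (simp add: field_simps)
    moreover have "(\<Sum>i<n. \<bar>integral {0..b i} e - integral {0..a i} e\<bar>)
        \<le> N * (\<Sum>i<n. b i - a i) + (\<Sum>i<n. integral {a i..b i} ?r)"
      using sum_mono[of "{..<n}", OF one] by (simp add: sum.distrib sum_distrib_left)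
    ultimately show "(\<Sum>i<n. \<bar>integral {0..b i} e - integral {0..a i} e\<bar>) < \<epsilon>"
      using N(3) by linarith
  qed
qed

lemma abs_continuous_on_diff:
  assumes "abs_continuous_on S f" "abs_continuous_on S g"
  shows "abs_continuous_on S (\<lambda>t. f t - g t)"
  unfolding abs_continuous_on_def
proof (intro allI impI)
  fix \<epsilon> :: real assume "0 < \<epsilon>"
  then have half: "0 < \<epsilon> / 2" by simp
  obtain d1 where d1: "d1 > 0 \<and> (\<forall>(n::nat) a b. (\<forall>i<n. a i \<le> b i \<and> {a i..b i} \<subseteq> S) \<longrightarrow>
       disjoint_family_on (\<lambda>i. {a i<..<b i}) {..<n} \<longrightarrow> (\<Sum>i<n. b i - a i) < d1 \<longrightarrow>
       (\<Sum>i<n. \<bar>f (b i) - f (a i)\<bar>) < \<epsilon> / 2)"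
    using assms(1)[unfolded abs_continuous_on_def, THEN spec, THEN mp, OF half] by (elim exE) (rule that)
  obtain d2 where d2: "d2 > 0 \<and> (\<forall>(n::nat) a b. (\<forall>i<n. a i \<le> b i \<and> {a i..b i} \<subseteq> S) \<longrightarrow>
       disjoint_family_on (\<lambda>i. {a i<..<b i}) {..<n} \<longrightarrow> (\<Sum>i<n. b i - a i) < d2 \<longrightarrow>
       (\<Sum>i<n. \<bar>g (b i) - g (a i)\<bar>) < \<epsilon> / 2)"
    using assms(2)[unfolded abs_continuous_on_def, THEN spec, THEN mp, OF half] by (elim exE) (rule that)
  show "\<exists>\<delta>>0. \<forall>(n::nat) a b. (\<forall>i<n. a i \<le> b i \<and> {a i..b i} \<subseteq> S) \<longrightarrow>
      disjoint_family_on (\<lambda>i. {a i<..<b i}) {..<n} \<longrightarrow> (\<Sum>i<n. b i - a i) < \<delta> \<longrightarrow>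
      (\<Sum>i<n. \<bar>f (b i) - g (b i) - (f (a i) - g (a i))\<bar>) < \<epsilon>"
  proof (intro exI[of _ "min d1 d2"] conjI allI impI)
    fix n :: nat and a b :: "nat \<Rightarrow> real"
    assume *: "\<forall>i<n. a i \<le> b i \<and> {a i..b i} \<subseteq> S"
      "disjoint_family_on (\<lambda>i. {a i<..<b i}) {..<n}" "(\<Sum>i<n. b i - a i) < min d1 d2"
    have "(\<Sum>i<n. \<bar>f (b i) - g (b i) - (f (a i) - g (a i))\<bar>)
       \<le> (\<Sum>i<n. \<bar>f (b i) - f (a i)\<bar> + \<bar>g (b i) - g (a i)\<bar>)"
      by (intro sum_mono) linarith
    also have "\<dots> < \<epsilon>"
      using d1[THEN conjunct2, rule_format, OF *(1)[rule_format] *(2)]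
        d2[THEN conjunct2, rule_format, OF *(1)[rule_format] *(2)] *(3) by (simp add: sum.distrib)
    finally show "(\<Sum>i<n. \<bar>f (b i) - g (b i) - (f (a i) - g (a i))\<bar>) < \<epsilon>" .
  qed (use d1 d2 in auto)
qed

lemma abs_continuous_on_eq:
  assumes "abs_continuous_on S f" "\<And>t. t \<in> S \<Longrightarrow> f t = g t"
  shows "abs_continuous_on S g"
  unfolding abs_continuous_on_def
proof (intro allI impI)
  fix \<epsilon> :: real assume "0 < \<epsilon>"
  obtain d where d: "d > 0 \<and> (\<forall>(n::nat) a b. (\<forall>i<n. a i \<le> b i \<and> {a i..b i} \<subseteq> S) \<longrightarrow>
       disjoint_family_on (\<lambda>i. {a i<..<b i}) {..<n} \<longrightarrow> (\<Sum>i<n. b i - a i) < d \<longrightarrow>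
       (\<Sum>i<n. \<bar>f (b i) - f (a i)\<bar>) < \<epsilon>)"
    using assms(1)[unfolded abs_continuous_on_def, THEN spec, THEN mp, OF \<open>0 < \<epsilon>\<close>] by (elim exE) (rule that)
  show "\<exists>\<delta>>0. \<forall>(n::nat) a b. (\<forall>i<n. a i \<le> b i \<and> {a i..b i} \<subseteq> S) \<longrightarrow>
      disjoint_family_on (\<lambda>i. {a i<..<b i}) {..<n} \<longrightarrow> (\<Sum>i<n. b i - a i) < \<delta> \<longrightarrow>
      (\<Sum>i<n. \<bar>g (b i) - g (a i)\<bar>) < \<epsilon>"
  proof (intro exI[of _ d] conjI allI impI)
    fix n :: nat and a b :: "nat \<Rightarrow> real"
    assume *: "\<forall>i<n. a i \<le> b i \<and> {a i..b i} \<subseteq> S"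
      "disjoint_family_on (\<lambda>i. {a i<..<b i}) {..<n}" "(\<Sum>i<n. b i - a i) < d"
    have "a i \<in> S" "b i \<in> S" if "i < n" for i using *(1) that by force+
    then have "(\<Sum>i<n. \<bar>g (b i) - g (a i)\<bar>) = (\<Sum>i<n. \<bar>f (b i) - f (a i)\<bar>)"
      by (intro sum.cong) (auto simp: assms(2))
    also have "\<dots> < \<epsilon>" using d[THEN conjunct2, rule_format, OF *(1)[rule_format] *(2,3)] by simp
    finally show "(\<Sum>i<n. \<bar>g (b i) - g (a i)\<bar>) < \<epsilon>" .
  qed (use d in simp)
qed

lemma abs_continuous_on_lipschitz:
  assumes L: "\<And>x y. x \<in> S \<Longrightarrow> y \<in> S \<Longrightarrow> \<bar>f x - f y\<bar> \<le> L * \<bar>x - y\<bar>"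
  shows "abs_continuous_on S f"
  unfolding abs_continuous_on_def
proof (intro allI impI)
  fix \<epsilon> :: real assume "0 < \<epsilon>"
  show "\<exists>\<delta>>0. \<forall>(n::nat) a b. (\<forall>i<n. a i \<le> b i \<and> {a i..b i} \<subseteq> S) \<longrightarrow>
      disjoint_family_on (\<lambda>i. {a i<..<b i}) {..<n} \<longrightarrow> (\<Sum>i<n. b i - a i) < \<delta> \<longrightarrow>
      (\<Sum>i<n. \<bar>f (b i) - f (a i)\<bar>) < \<epsilon>"
  proof (intro exI[of _ "\<epsilon> / (\<bar>L\<bar> + 1)"] conjI allI impI)
    fix n :: nat and a b :: "nat \<Rightarrow> real"
    assume ab: "\<forall>i<n. a i \<le> b i \<and> {a i..b i} \<subseteq> S" and small: "(\<Sum>i<n. b i - a i) < \<epsilon> / (\<bar>L\<bar> + 1)"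
    have "(\<Sum>i<n. \<bar>f (b i) - f (a i)\<bar>) \<le> (\<Sum>i<n. (\<bar>L\<bar> + 1) * (b i - a i))"
    proof (intro sum_mono)
      fix i assume i: "i \<in> {..<n}"
      then have le: "a i \<le> b i" and sub: "{a i..b i} \<subseteq> S" using ab by auto
      then have "\<bar>f (b i) - f (a i)\<bar> \<le> L * \<bar>b i - a i\<bar>" by (intro L) auto
      also have "\<dots> \<le> (\<bar>L\<bar> + 1) * (b i - a i)" using le by (auto intro!: mult_mono)
      finally show "\<bar>f (b i) - f (a i)\<bar> \<le> (\<bar>L\<bar> + 1) * (b i - a i)" .
    qed
    also have "\<dots> = (\<bar>L\<bar> + 1) * (\<Sum>i<n. b i - a i)" by (simp add: sum_distrib_left)
    also have "\<dots> < \<epsilon>" using small by (simp add: field_simps)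
    finally show "(\<Sum>i<n. \<bar>f (b i) - f (a i)\<bar>) < \<epsilon>" .
  qed (use \<open>0 < \<epsilon>\<close> in auto)
qed

lemma indefinite_integral_right_derivative:
  fixes f :: "real \<Rightarrow> real"
  assumes "\<And>a b. f integrable_on {a..b}"
  obtains N where "negligible N"
    "\<And>x \<epsilon>. x \<notin> N \<Longrightarrow> 0 < \<epsilon> \<Longrightarrow>
       \<exists>d>0. \<forall>h. 0 < h \<and> h < d \<longrightarrow> \<bar>integral {x..x + h} f / h - f x\<bar> < \<epsilon>"
proof -
  have "\<And>a b. f integrable_on cbox a b" using assms by simp
  then obtain N where N: "negligible N" "\<And>x \<epsilon>. x \<notin> N \<Longrightarrow> 0 < \<epsilon> \<Longrightarrow>
      \<exists>d>0. \<forall>h. 0 < h \<and> h < d \<longrightarrow>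
        norm (integral (cbox x (x + h *\<^sub>R One)) f /\<^sub>R h ^ DIM(real) - f x) < \<epsilon>"
    using integrable_ccontinuous_explicit[of f] by blast
  show thesis
  proof (rule that[OF N(1)])
    fix x \<epsilon> :: real assume "x \<notin> N" "0 < \<epsilon>"
    from N(2)[OF this]
    show "\<exists>d>0. \<forall>h. 0 < h \<and> h < d \<longrightarrow> \<bar>integral {x..x + h} f / h - f x\<bar> < \<epsilon>"
      by (simp add: divide_inverse mult.commute)
  qed
qed

text \<open>
  Lebesgue's differentiation theorem. The right derivative of the integral is known almost
  everywhere; the left one is the right derivative for the reflected function.
\<close>

lemma indefinite_integral_has_derivative_ae:
  fixes e :: "real \<Rightarrow> real"
  assumes e: "e integrable_on {a..b}"
  obtains N where "negligible N"
    "\<And>t. t \<in> {a..b} - N \<Longrightarrow> ((\<lambda>x. integral {a..x} e) has_real_derivative e t) (at t within {a..b})"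
proof -
  define f where "f x = (if x \<in> {a..b} then e x else 0)" for x
  have "f integrable_on UNIV"
    unfolding f_def by (subst integrable_restrict_UNIV) (rule e)
  then have f: "f integrable_on {c..d}" for c d by (rule integrable_on_subinterval) simp
  have "(\<lambda>x. f (-x)) integrable_on {c..d}" for c d
    using f[of "-d" "-c"] Henstock_Kurzweil_Integration.integrable_reflect_real[of f "-c" "-d"] by simp
  then obtain M where M: "negligible M" "\<And>x \<epsilon>. x \<notin> M \<Longrightarrow> 0 < \<epsilon> \<Longrightarrow>
       \<exists>d>0. \<forall>h. 0 < h \<and> h < d \<longrightarrow> \<bar>integral {x..x + h} (\<lambda>x. f (-x)) / h - f (-x)\<bar> < \<epsilon>"
    using indefinite_integral_right_derivative[of "\<lambda>x. f (-x)"] by blast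
  obtain N where N: "negligible N" "\<And>x \<epsilon>. x \<notin> N \<Longrightarrow> 0 < \<epsilon> \<Longrightarrow>
       \<exists>d>0. \<forall>h. 0 < h \<and> h < d \<longrightarrow> \<bar>integral {x..x + h} f / h - f x\<bar> < \<epsilon>"
    using indefinite_integral_right_derivative[OF f] by blast
  have negM: "negligible (uminus ` M)"
    by (rule negligible_differentiable_image_negligible) (use M in \<open>auto intro!: derivative_intros\<close>)
  have ef: "integral {c..d} e = integral {c..d} f" if "{c..d} \<subseteq> {a..b}" for c d
    using that by (intro integral_cong) (auto simp: f_def)
  show thesis
  proof (rule that[of "N \<union> uminus ` M"])
    show "negligible (N \<union> uminus ` M)" using N negM by simp
    fix t assume t: "t \<in> {a..b} - (N \<union> uminus ` M)"
    then have "t \<notin> N" "- t \<notin> M" by force+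
    have ft: "f t = e t" using t by (simp add: f_def)
    have diff: "integral {a..y} e - integral {a..x} e = integral {x..y} f"
      if "x \<le> y" "x \<in> {a..b}" "y \<in> {a..b}" for x y
      using that Henstock_Kurzweil_Integration.integral_combine[of a x y f] f by (simp add: ef)
    show "((\<lambda>x. integral {a..x} e) has_real_derivative e t) (at t within {a..b})"
      unfolding has_field_derivative_iff Lim_within
    proof (intro allI impI)
      fix \<epsilon> :: real assume "0 < \<epsilon>"
      obtain d1 where d1: "d1 > 0" "\<And>h. 0 < h \<Longrightarrow> h < d1 \<Longrightarrow> \<bar>integral {t..t + h} f / h - f t\<bar> < \<epsilon>"
        using N(2)[OF \<open>t \<notin> N\<close> \<open>0 < \<epsilon>\<close>] by blast
      obtain d2 where d2: "d2 > 0"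
        "\<And>h. 0 < h \<Longrightarrow> h < d2 \<Longrightarrow> \<bar>integral {-t..-t + h} (\<lambda>x. f (-x)) / h - f t\<bar> < \<epsilon>"
        using M(2)[OF \<open>-t \<notin> M\<close> \<open>0 < \<epsilon>\<close>] by auto
      show "\<exists>d>0. \<forall>x\<in>{a..b}. 0 < dist x t \<and> dist x t < d \<longrightarrow>
          dist ((integral {a..x} e - integral {a..t} e) / (x - t)) (e t) < \<epsilon>"
      proof (intro exI[of _ "min d1 d2"] conjI ballI impI)
        fix x assume x: "x \<in> {a..b}" and dist: "0 < dist x t \<and> dist x t < min d1 d2"
        show "dist ((integral {a..x} e - integral {a..t} e) / (x - t)) (e t) < \<epsilon>"
        proof (cases "t < x")
          case True
          then show ?thesis using d1(2)[of "x - t"] diff[of t x] x t dist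
            by (simp add: dist_real_def ft)
        next
          case False
          then have "x < t" using dist by auto
          moreover have "integral {-t..-x} (\<lambda>x. f (-x)) = integral {x..t} f"
            by (rule Henstock_Kurzweil_Integration.integral_reflect_real)
          moreover have "(integral {a..x} e - integral {a..t} e) / (x - t)
            = (integral {a..t} e - integral {a..x} e) / (t - x)"
            by (metis minus_diff_eq minus_divide_divide)
          ultimately show ?thesis using d2(2)[of "t - x"] diff[of x t] x t dist
            by (simp add: dist_real_def ft)
        qed
      qed (use d1 d2 in auto)
    qed
  qed
qed

section \<open>Energy estimate and truncation\<close>

lemma continuous_imp_antiderivative:
  fixes g :: "real \<Rightarrow> real"
  assumes "continuous_on UNIV g"
  obtains G where "\<And>x. (G has_real_derivative g x) (at x)"
proof -
  have "isCont g x" for x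
    using assms by (simp add: continuous_on_eq_continuous_at)
  then obtain G where G: "\<And>x. (G has_vector_derivative g x) (at x)"
    using einterval_antiderivative[of "-\<infinity>" "\<infinity>" g] by auto
  show thesis
    by (rule that[of G]) (simp add: has_real_derivative_iff_has_vector_derivative G)
qed

text \<open>
  The integrand is the derivative of \<open>G \<circ> u\<close> for an antiderivative \<open>G\<close> of \<open>g\<close>. This is how the
  free constant and the nonlinearity drop out of the energy estimate.
\<close>

lemma has_integral_periodic_composition:
  fixes u :: "real \<Rightarrow> real"
  assumes "a \<le> b" "continuous_on UNIV g"
    and u: "\<And>t. t \<in> {a..b} \<Longrightarrow> (u has_real_derivative du t) (at t within {a..b})"
    and "u a = u b"
  shows "((\<lambda>t. g (u t) * du t) has_integral 0) {a..b}"
proof -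
  obtain G where G: "\<And>x. (G has_real_derivative g x) (at x)"
    using continuous_imp_antiderivative[OF assms(2)] by blast
  have "((\<lambda>t. g (u t) * du t) has_integral G (u b) - G (u a)) {a..b}"
  proof (rule fundamental_theorem_of_calculus[OF \<open>a \<le> b\<close>])
    fix t assume "t \<in> {a..b}"
    from DERIV_chain2[OF G u[OF this]]
    show "((\<lambda>t. G (u t)) has_vector_derivative g (u t) * du t) (at t within {a..b})"
      by (simp add: has_real_derivative_iff_has_vector_derivative)
  qed
  then show ?thesis using \<open>u a = u b\<close> by simp
qed

text \<open>
  When \<open>\<bar>c\<bar>\<close> equals the bound \<open>M + B\<close> of \<open>E - g\<close>, the constant determines the sign of the argument of
  \<open>\<psi>\<close>, hence that of the right-hand side.
\<close>

lemma periodic_solution_bounded_nonlinearity: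
  fixes \<psi> :: "real \<Rightarrow> real \<Rightarrow> real"
  assumes "T > 0"
    and \<psi>: "continuous_on UNIV (\<lambda>(t, y). \<psi> t y)"
      "\<And>t y. 0 \<le> y \<Longrightarrow> 0 \<le> \<psi> t y" "\<And>t y. y \<le> 0 \<Longrightarrow> \<psi> t y \<le> 0"
      "\<And>R. \<exists>K. \<forall>t y. \<bar>y\<bar> \<le> R \<longrightarrow> \<bar>\<psi> t y\<bar> \<le> K"
    and E: "continuous_on UNIV E" "\<And>t. \<bar>E t\<bar> \<le> M"
    and g: "continuous_on UNIV g" "\<And>x. \<bar>g x\<bar> \<le> B"
  obtains c u where
    "\<And>t. t \<in> {0..T} \<Longrightarrow> (u has_real_derivative \<psi> t (c + E t - g (u t))) (at t within {0..T})"
    "u 0 = u T" "integral {0..T} u = 0"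
proof -
  obtain K where K: "\<And>t y. \<bar>y\<bar> \<le> 2 * (M + B) \<Longrightarrow> \<bar>\<psi> t y\<bar> \<le> K" using \<psi>(4) by meson
  let ?f = "\<lambda>c t x. \<psi> t (c + E t - g x)"
  have Eg: "\<bar>E t - g x\<bar> \<le> M + B" for t x using E(2)[of t] g(2)[of x] by linarith
  show thesis
  proof (rule periodic_solution_with_parameter[where f = ?f and T = T and C = "M + B" and K = K])
    show "0 \<le> M + B" using Eg[of 0 0] by linarith
    have "continuous_on UNIV (\<lambda>v. E (fst (snd v)))" "continuous_on UNIV (\<lambda>v. g (snd (snd v)))"
      by (rule continuous_on_compose2[OF E(1)] continuous_on_compose2[OF g(1)]; intro continuous_intros subset_UNIV)+
    then have "continuous_on UNIV (\<lambda>v. ?f (fst v) (fst (snd v)) (snd (snd v)))"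
      by (intro continuous_on_compose2[OF \<psi>(1), where f = "\<lambda>v. (fst (snd v), fst v + E (fst (snd v)) - g (snd (snd v)))", simplified]
          continuous_intros)
    then show "continuous_on UNIV (\<lambda>(c, t, x). ?f c t x)" by (simp add: case_prod_unfold)
    show "\<bar>?f c t x\<bar> \<le> K" if "\<bar>c\<bar> \<le> M + B" for c t x
      using that Eg[of t x] abs_triangle_ineq[of c "E t - g x"]
      by (intro K) (simp add: add_diff_eq)
    show "0 \<le> ?f (M + B) t x" for t x using Eg[of t x] by (intro \<psi>(2)) linarith
    show "?f (- (M + B)) t x \<le> 0" for t x using Eg[of t x] by (intro \<psi>(3)) linarith
  qed (use \<open>T > 0\<close> that in auto)
qed

text \<open>
  The energy estimate. Write \<open>y = c + E - g(u)\<close>, so that \<open>u' = \<psi>(t, y)\<close>. By periodicity \<open>c - g(u)\<close>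
  contributes nothing to \<open>\<integral> y u'\<close>, whence \<open>\<integral> y u' = \<integral> E u' \<le> M \<integral> \<bar>u'\<bar>\<close>. On the other hand \<open>y u' = \<bar>y\<bar> \<bar>u'\<bar>\<close>
  is at least \<open>(M + 1) \<bar>u'\<bar>\<close> except where \<open>\<bar>y\<bar> \<le> M + 1\<close>, and there \<open>\<bar>u'\<bar> \<le> K\<close>. So \<open>\<integral> \<bar>u'\<bar> \<le> (M + 1) K T\<close>,
  which bounds the oscillation of \<open>u\<close> and, as \<open>u\<close> has mean zero, \<open>u\<close> itself. The point is that the bound
  is independent of \<open>g\<close> and \<open>c\<close>.
\<close>

lemma periodic_solution_a_priori_bound:
  fixes \<psi> :: "real \<Rightarrow> real \<Rightarrow> real"
  assumes "T > 0"
    and \<psi>: "continuous_on UNIV (\<lambda>(t, y). \<psi> t y)"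
      "\<And>t y. 0 \<le> y \<Longrightarrow> 0 \<le> \<psi> t y" "\<And>t y. y \<le> 0 \<Longrightarrow> \<psi> t y \<le> 0"
    and K: "\<And>t y. \<bar>y\<bar> \<le> M + 1 \<Longrightarrow> \<bar>\<psi> t y\<bar> \<le> K"
    and E: "continuous_on UNIV E" "\<And>t. \<bar>E t\<bar> \<le> M"
    and g: "continuous_on UNIV g"
    and u: "\<And>t. t \<in> {0..T} \<Longrightarrow> (u has_real_derivative \<psi> t (c + E t - g (u t))) (at t within {0..T})"
      "u 0 = u T" "integral {0..T} u = 0"
    and t: "t \<in> {0..T}"
  shows "\<bar>u t\<bar> \<le> (M + 1) * K * T"
proof -
  define du where "du t = \<psi> t (c + E t - g (u t))" for t
  have M: "0 \<le> M" using E(2)[of 0] by linarith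
  have contu: "continuous_on {0..T} u"
    using u(1) by (metis DERIV_continuous continuous_on_eq_continuous_within)
  have contdu: "continuous_on {0..T} du"
    unfolding du_def
    by (intro continuous_on_compose2[OF \<psi>(1), where f = "\<lambda>t. (t, c + E t - g (u t))", simplified]
          continuous_intros continuous_on_subset[OF E(1)] continuous_on_compose2[OF g contu]) auto
  have zero: "((\<lambda>t. (c - g (u t)) * du t) has_integral 0) {0..T}"
    by (rule has_integral_periodic_composition[where g = "\<lambda>x. c - g x"])
       (use \<open>T > 0\<close> u in \<open>auto simp: du_def intro!: continuous_intros g\<close>)
  have pointwise: "\<bar>du s\<bar> \<le> (M + 1) * K + (c - g (u s)) * du s" for s
  proof -
    let ?y = "c + E s - g (u s)"
    have nonneg: "0 \<le> ?y * du s"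
      using \<psi>(2,3)[of ?y s]
      by (cases "0 \<le> ?y") (auto simp: du_def intro: mult_nonneg_nonneg mult_nonpos_nonpos)
    have "(M + 1) * (\<bar>du s\<bar> - K) \<le> ?y * du s"
    proof (cases "\<bar>?y\<bar> \<le> M + 1")
      case True
      then have "\<bar>du s\<bar> - K \<le> 0" using K[OF True, of s] by (simp add: du_def)
      then have "(M + 1) * (\<bar>du s\<bar> - K) \<le> 0" using M by (simp add: mult_nonneg_nonpos)
      then show ?thesis using nonneg by linarith
    next
      case False
      have "0 \<le> K" using K[of 0 0] M by linarith
      then have "(M + 1) * (\<bar>du s\<bar> - K) \<le> (M + 1) * \<bar>du s\<bar>" using M by (intro mult_left_mono) auto
      also have "\<dots> \<le> \<bar>?y\<bar> * \<bar>du s\<bar>" using False by (intro mult_right_mono) auto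
      also have "\<dots> = ?y * du s"
        using nonneg abs_mult[of ?y "du s"] by simp
      finally show ?thesis .
    qed
    moreover have "E s * du s \<le> M * \<bar>du s\<bar>"
      using mult_right_mono[OF E(2)[of s], of "\<bar>du s\<bar>"] abs_ge_self[of "E s * du s"] by (simp add: abs_mult)
    ultimately show ?thesis by (simp add: algebra_simps)
  qed
  have absint: "(\<lambda>s. \<bar>du s\<bar>) integrable_on {x..y}" if "{x..y} \<subseteq> {0..T}" for x y
    by (intro integrable_continuous_real continuous_intros continuous_on_subset[OF contdu that])
  have "((\<lambda>s. (M + 1) * K + (c - g (u s)) * du s) has_integral (M + 1) * K * T + 0) {0..T}"
    using has_integral_const_real[of "(M + 1) * K" 0 T] \<open>T > 0\<close>
    by (intro has_integral_add zero) (simp add: mult.commute)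
  then have total: "integral {0..T} (\<lambda>s. \<bar>du s\<bar>) \<le> (M + 1) * K * T"
    using has_integral_le[OF integrable_integral[OF absint[of 0 T]]] pointwise by simp
  have ordered: "\<bar>u y - u x\<bar> \<le> (M + 1) * K * T" if "x \<le> y" "x \<in> {0..T}" "y \<in> {0..T}" for x y
  proof -
    have "(du has_integral (u y - u x)) {x..y}"
    proof (rule fundamental_theorem_of_calculus[OF \<open>x \<le> y\<close>])
      fix s assume "s \<in> {x..y}"
      then show "(u has_vector_derivative du s) (at s within {x..y})"
        using u(1)[of s] that
        by (auto simp: has_real_derivative_iff_has_vector_derivative du_def intro: has_vector_derivative_within_subset)
    qed
    then have "\<bar>u y - u x\<bar> \<le> integral {x..y} (\<lambda>s. \<bar>du s\<bar>)"
      using integral_norm_bound_integral[of du "{x..y}" "\<lambda>s. \<bar>du s\<bar>"] absint[of x y] that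
      by (auto simp: has_integral_iff)
    also have "\<dots> \<le> integral {0..T} (\<lambda>s. \<bar>du s\<bar>)"
      using that by (intro integral_subset_le absint) auto
    finally show ?thesis using total by linarith
  qed
  \<comment> \<open>As \<open>u\<close> has integral zero, \<open>u t * T\<close> is the integral of \<open>u t - u s\<close> over \<open>s\<close>.\<close>
  have osc: "\<bar>u t - u s\<bar> \<le> (M + 1) * K * T" if "s \<in> {0..T}" for s
    using ordered[of s t] ordered[of t s] that t by (cases "s \<le> t") auto
  have "((\<lambda>s. u t - u s) has_integral (u t * T - 0)) {0..T}"
    using has_integral_const_real[of "u t" 0 T] \<open>T > 0\<close> integrable_integral[OF integrable_continuous_real[OF contu]] u(3)
    by (intro has_integral_diff) (auto simp: mult.commute)
  moreover have "continuous_on {0..T} (\<lambda>s. u t - u s)" by (intro continuous_intros contu)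
  ultimately have "\<bar>u t * T\<bar> \<le> (M + 1) * K * T * T"
    using integral_bound[of 0 T "\<lambda>s. u t - u s" "(M + 1) * K * T"] osc \<open>T > 0\<close>
    by (simp add: has_integral_iff)
  then show ?thesis using \<open>T > 0\<close> by (simp add: abs_mult)
qed

text \<open>
  Replacing \<open>g\<close> outside \<open>[-R, R]\<close> by its boundary values makes it bounded. For \<open>R\<close> the a priori bound,
  which holds for the truncated problem as well, the solution found never meets the truncation.
\<close>

lemma periodic_solution_monotone_first_order:
  fixes \<psi> :: "real \<Rightarrow> real \<Rightarrow> real"
  assumes "T > 0"
    and \<psi>: "continuous_on UNIV (\<lambda>(t, y). \<psi> t y)"
      "\<And>t y. 0 \<le> y \<Longrightarrow> 0 \<le> \<psi> t y" "\<And>t y. y \<le> 0 \<Longrightarrow> \<psi> t y \<le> 0"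
      "\<And>R. \<exists>K. \<forall>t y. \<bar>y\<bar> \<le> R \<longrightarrow> \<bar>\<psi> t y\<bar> \<le> K"
    and E: "continuous_on UNIV E" "\<And>t. \<bar>E t\<bar> \<le> M"
    and g: "continuous_on UNIV g"
  obtains c u where
    "\<And>t. t \<in> {0..T} \<Longrightarrow> (u has_real_derivative \<psi> t (c + E t - g (u t))) (at t within {0..T})"
    "u 0 = u T" "integral {0..T} u = 0"
proof -
  obtain K where K: "\<And>t y. \<bar>y\<bar> \<le> M + 1 \<Longrightarrow> \<bar>\<psi> t y\<bar> \<le> K" using \<psi>(4) by meson
  define R where "R = (M + 1) * K * T"
  have "0 \<le> M" using E(2)[of 0] by linarith
  moreover from this have "0 \<le> K" using K[of 0 0] by linarith
  ultimately have R: "0 \<le> R" using \<open>T > 0\<close> by (simp add: R_def)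
  define gR where "gR x = g (max (-R) (min R x))" for x
  have gR: "continuous_on UNIV gR"
    unfolding gR_def by (rule continuous_on_compose2[OF g]) (intro continuous_intros subset_UNIV)+
  have "bounded (g ` {-R..R})"
    by (intro compact_imp_bounded compact_continuous_image continuous_on_subset[OF g]) auto
  then obtain B where B: "\<And>x. x \<in> {-R..R} \<Longrightarrow> \<bar>g x\<bar> \<le> B"
    unfolding bounded_iff ball_simps(9) real_norm_def by blast
  have gRB: "\<bar>gR x\<bar> \<le> B" for x unfolding gR_def using R by (intro B) auto
  obtain c u where u:
    "\<And>t. t \<in> {0..T} \<Longrightarrow> (u has_real_derivative \<psi> t (c + E t - gR (u t))) (at t within {0..T})"
    "u 0 = u T" "integral {0..T} u = 0"
    using periodic_solution_bounded_nonlinearity[OF \<open>T > 0\<close> \<psi> E gR gRB] by blast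
  have "gR (u t) = g (u t)" if "t \<in> {0..T}" for t
  proof -
    have "\<bar>u t\<bar> \<le> R"
      unfolding R_def by (rule periodic_solution_a_priori_bound[OF \<open>T > 0\<close> \<psi>(1-3) K E gR u that])
    then show ?thesis by (simp add: gR_def abs_le_iff max_absorb2 min_absorb2)
  qed
  then show thesis using u by (intro that[of u c]) auto
qed

section \<open>The variable exponent problem\<close>

text \<open>
  The inverse \<open>\<bar>y\<bar> powr (1 / (q - 1)) * sgn y\<close> of \<open>phi q\<close>, written as a difference of powers of the
  positive and negative parts: both summands are continuous at \<open>y = 0\<close>, while \<open>sgn\<close> is not.
\<close>

definition phi_inverse :: "real \<Rightarrow> real \<Rightarrow> real" where
  "phi_inverse q y = max y 0 powr (1 / (q - 1)) - max (- y) 0 powr (1 / (q - 1))"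

lemma phi_phi_inverse:
  assumes "q > 1"
  shows "phi q (phi_inverse q y) = y"
proof -
  have pos: "(x powr (1 / (q - 1))) powr (q - 2) * x powr (1 / (q - 1)) = x" if "x > 0" for x :: real
  proof -
    have "(q - 2) / (q - 1) + 1 / (q - 1) = 1" using assms by (simp add: field_simps)
    then show ?thesis using that by (simp add: powr_powr powr_add[symmetric])
  qed
  show ?thesis
    using pos[of y] pos[of "- y"] by (cases y "0 :: real" rule: linorder_cases)
      (auto simp: phi_def phi_inverse_def max_def)
qed

lemma phi_inverse_nonneg: "0 \<le> y \<Longrightarrow> 0 \<le> phi_inverse q y"
  and phi_inverse_nonpos: "y \<le> 0 \<Longrightarrow> phi_inverse q y \<le> 0"
  by (auto simp: phi_inverse_def max_def)

lemma continuous_on_phi_inverse: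
  assumes "continuous_on S q" "continuous_on S y" "\<And>x. x \<in> S \<Longrightarrow> q x > 1"
  shows "continuous_on S (\<lambda>x. phi_inverse (q x) (y x))"
  unfolding phi_inverse_def
  using assms(3) by (intro continuous_intros continuous_on_powr' assms(1,2)) force+

theorem theorem2p7:
  fixes T :: real and p \<theta> e :: "real \<Rightarrow> real"
  assumes "T > 0"
    and "continuous_on {0..T} p" and "\<forall>t\<in>{0..T}. p t > 1" and "p 0 = p T"
    and "continuous_on UNIV \<theta>"
    and "set_integrable lebesgue {0..T} e"
    and "(LINT t:{0..T}|lebesgue. e t) = 0"
  shows "\<exists>u. periodic_solution T p \<theta> e u \<and> mean T u = 0"
proof -
  \<comment> \<open>All data are extended continuously from \<open>[0, T]\<close> to the line by clipping the time.\<close>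
  define cl where "cl t = max 0 (min T t)" for t
  have cl: "cl t \<in> {0..T}" "t \<in> {0..T} \<Longrightarrow> cl t = t" for t
    using \<open>T > 0\<close> by (auto simp: cl_def)
  have contcl: "continuous_on S cl" for S unfolding cl_def by (intro continuous_intros)
  define E where "E t = integral {0..cl t} e" for t
  define \<psi> where "\<psi> t y = phi_inverse (p (cl t)) y" for t y
  note e = set_lebesgue_integral_eq_integral[OF assms(6)]
  have contint: "continuous_on {0..T} (\<lambda>t. integral {0..t} e)"
    by (rule indefinite_integral_continuous_1[OF e(1)])
  have contE: "continuous_on UNIV E"
    unfolding E_def by (rule continuous_on_compose2[OF contint contcl]) (use cl in auto)
  have "bounded ((\<lambda>t. integral {0..t} e) ` {0..T})"
    by (intro compact_imp_bounded compact_continuous_image contint) simp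
  then obtain M where M: "\<And>t. t \<in> {0..T} \<Longrightarrow> \<bar>integral {0..t} e\<bar> \<le> M"
    unfolding bounded_iff ball_simps(9) real_norm_def by blast
  have EM: "\<bar>E t\<bar> \<le> M" for t unfolding E_def by (rule M[OF cl(1)])
  have cont\<psi>: "continuous_on UNIV (\<lambda>(t, y). \<psi> t y)"
  proof -
    have "continuous_on UNIV (\<lambda>v. p (cl (fst v)))"
      by (rule continuous_on_compose2[OF assms(2) continuous_on_compose2[OF contcl[of UNIV]]])
        (use cl in \<open>auto intro: continuous_intros\<close>)
    then show ?thesis
      unfolding \<psi>_def case_prod_unfold
      using cl assms(3) by (intro continuous_on_phi_inverse continuous_intros) auto
  qed
  have sign\<psi>: "0 \<le> y \<Longrightarrow> 0 \<le> \<psi> t y" "y \<le> 0 \<Longrightarrow> \<psi> t y \<le> 0" for t y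
    by (simp_all add: \<psi>_def phi_inverse_nonneg phi_inverse_nonpos)
  have bound\<psi>: "\<exists>K. \<forall>t y. \<bar>y\<bar> \<le> R \<longrightarrow> \<bar>\<psi> t y\<bar> \<le> K" for R
  proof -
    have "bounded ((\<lambda>(t, y). \<psi> t y) ` ({0..T} \<times> {-R..R}))"
      by (intro compact_imp_bounded compact_continuous_image continuous_on_subset[OF cont\<psi>] compact_Times) auto
    then obtain K where K: "\<And>t y. t \<in> {0..T} \<Longrightarrow> y \<in> {-R..R} \<Longrightarrow> \<bar>\<psi> t y\<bar> \<le> K"
      unfolding bounded_iff ball_simps(9) real_norm_def by (auto simp: Ball_def)
    have "\<bar>\<psi> t y\<bar> \<le> K" if "\<bar>y\<bar> \<le> R" for t y
    proof -
      have "\<psi> (cl t) y = \<psi> t y" by (simp add: \<psi>_def cl(2)[OF cl(1)])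
      with K[OF cl(1), of y t] that show ?thesis by (simp add: abs_le_iff)
    qed
    then show ?thesis by blast
  qed
  obtain \<Theta> where \<Theta>: "\<And>x. (\<Theta> has_real_derivative \<theta> x) (at x)"
    using continuous_imp_antiderivative[OF assms(5)] by blast
  have cont\<Theta>: "continuous_on S \<Theta>" for S
    using \<Theta> by (meson DERIV_isCont continuous_at_imp_continuous_on)
  obtain c u where u:
    "\<And>t. t \<in> {0..T} \<Longrightarrow> (u has_real_derivative \<psi> t (c + E t - \<Theta> (u t))) (at t within {0..T})"
    "u 0 = u T" "integral {0..T} u = 0"
    using periodic_solution_monotone_first_order[OF \<open>T > 0\<close> cont\<psi> sign\<psi> bound\<psi> contE EM cont\<Theta>]
    by blast
  define du where "du t = \<psi> t (c + E t - \<Theta> (u t))" for t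
  have contu: "continuous_on {0..T} u"
    using u(1) by (metis DERIV_continuous continuous_on_eq_continuous_within)
  have contdu: "continuous_on {0..T} du"
    unfolding du_def
    by (intro continuous_on_compose2[OF cont\<psi>, where f = "\<lambda>t. (t, c + E t - \<Theta> (u t))", simplified]
          continuous_intros continuous_on_subset[OF contE] continuous_on_compose2[OF cont\<Theta>[of UNIV] contu]) auto
  \<comment> \<open>The integrated equation, \<open>\<Theta>\<close> being an antiderivative of \<open>\<theta>\<close>.\<close>
  have flux: "phi (p t) (du t) = integral {0..t} e - (\<Theta> (u t) - c)" if "t \<in> {0..T}" for t
    using that assms(3) by (simp add: du_def \<psi>_def cl(2) E_def phi_phi_inverse)
  have d\<Theta>: "((\<lambda>t. \<Theta> (u t) - c) has_real_derivative \<theta> (u t) * du t) (at t within {0..T})"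
    if "t \<in> {0..T}" for t
    using DERIV_chain2[OF \<Theta> u(1)[OF that]] unfolding du_def by (auto intro!: derivative_eq_intros)
  have ac: "abs_continuous_on {0..T} (\<lambda>t. integral {0..t} e - (\<Theta> (u t) - c))"
  proof (rule abs_continuous_on_diff[OF abs_continuous_on_integral[OF assms(6)]])
    have "bounded ((\<lambda>t. \<theta> (u t) * du t) ` {0..T})"
      by (intro compact_imp_bounded compact_continuous_image continuous_intros contdu
          continuous_on_compose2[OF assms(5) contu]) auto
    then obtain L where L: "\<And>t. t \<in> {0..T} \<Longrightarrow> \<bar>\<theta> (u t) * du t\<bar> \<le> L"
      unfolding bounded_iff ball_simps(9) real_norm_def by blast
    show "abs_continuous_on {0..T} (\<lambda>t. \<Theta> (u t) - c)"
    proof (rule abs_continuous_on_lipschitz)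
      fix x y assume "x \<in> {0..T}" "y \<in> {0..T}"
      then show "\<bar>\<Theta> (u x) - c - (\<Theta> (u y) - c)\<bar> \<le> L * \<bar>x - y\<bar>"
        using field_differentiable_bound[OF _ d\<Theta>, of L x y] L by simp
    qed
  qed
  obtain N where N: "negligible N" "\<And>t. t \<in> {0..T} - N \<Longrightarrow>
      ((\<lambda>x. integral {0..x} e) has_real_derivative e t) (at t within {0..T})"
    using indefinite_integral_has_derivative_ae[OF e(1)] by blast
  have "periodic_solution T p \<theta> e u"
    unfolding periodic_solution_def
  proof (intro exI[of _ du] conjI ballI)
    show "(u has_real_derivative du t) (at t within {0..T})" if "t \<in> {0..T}" for t
      using u(1)[OF that] by (simp add: du_def)
    show "du 0 = du T"
      using \<open>T > 0\<close> u(2) e(2) assms(4,7) by (simp add: du_def \<psi>_def E_def cl(2))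
    show "abs_continuous_on {0..T} (\<lambda>t. phi (p t) (du t))"
      by (rule abs_continuous_on_eq[OF ac]) (simp add: flux)
    have "\<exists>w. ((\<lambda>s. phi (p s) (du s)) has_real_derivative w) (at t within {0..T}) \<and> w + \<theta> (u t) * du t = e t"
      if t: "t \<in> {0..T} - N" for t
    proof (intro exI conjI)
      show "((\<lambda>s. phi (p s) (du s)) has_real_derivative e t - \<theta> (u t) * du t) (at t within {0..T})"
      proof (rule has_field_derivative_transform_within[OF _ zero_less_one])
        show "((\<lambda>t. integral {0..t} e - (\<Theta> (u t) - c)) has_real_derivative e t - \<theta> (u t) * du t) (at t within {0..T})"
          using t by (intro DERIV_diff N(2) d\<Theta>) auto
      qed (use t flux in auto)
    qed simp
    then show "AE t\<in>{0..T} in lebesgue. \<exists>w. ((\<lambda>s. phi (p s) (du s)) has_real_derivative w) (at t within {0..T})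
       \<and> w + \<theta> (u t) * du t = e t"
      using N(1) by (intro AE_I'[of N]) (auto simp: negligible_iff_null_sets)
  qed (use u contdu in auto)
  moreover have "mean T u = 0"
    using set_lebesgue_integral_eq_integral(2)[OF absolutely_integrable_continuous_real[OF contu]] u(3)
    by (simp add: mean_def)
  ultimately show ?thesis by blast
qed

end
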